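(* Let $G$ be a connected graph with $m\ge 5$ edges and maximum degree $\Delta(G)$, and let $s$ be a positive integer. (i) If $\Delta(G)\le s$ and $s\ge \frac{2m}{3}$, then $q(G)\le s+2$. (ii) If $s\le \Delta(G)\le m-1$, then $q(G)>s+1$.
   Context: $q(G)$ denotes the $Q$-index of $G$, i.e. the largest eigenvalue of the signless Laplacian $Q(G)=D(G)+A(G)$ (degree diagonal matrix plus adjacency matrix). *)

theory Defs
  imports
    "Graph_Theory.Digraph_Component"
    "Jordan_Normal_Form.Spectral_Radius"
begin

text \<open>
  A finite simple undirected graph is a \<open>graph\<close> in the sense of Graph\_Theory: a finite,
  loop-free, symmetric digraph without parallel arcs, so that an undirected edge is a pair of
  opposite arcs. Hence the degree of a vertex is its out-degree, and edges are counted as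
  unordered pairs of end points.
\<close>

definition edge_set :: "('a, 'b) pre_digraph \<Rightarrow> 'a set set" where
  "edge_set G = {{u, v} |u v. (u, v) \<in> arcs_ends G}"

definition max_degree :: "('a, 'b) pre_digraph \<Rightarrow> nat" where
  "max_degree G = Max (out_degree G ` verts G)"

text \<open>The list \<open>vs\<close> enumerates the vertices; it fixes the order of rows and columns.\<close>

definition degree_mat :: "('a, 'b) pre_digraph \<Rightarrow> 'a list \<Rightarrow> real mat" where
  "degree_mat G vs = mat (length vs) (length vs)
     (\<lambda>(i, j). if i = j then real (out_degree G (vs ! i)) else 0)"

definition adjacency_mat :: "('a, 'b) pre_digraph \<Rightarrow> 'a list \<Rightarrow> real mat" where
  "adjacency_mat G vs = mat (length vs) (length vs)
     (\<lambda>(i, j). if (vs ! i, vs ! j) \<in> arcs_ends G then 1 else 0)"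

definition signless_laplacian :: "('a, 'b) pre_digraph \<Rightarrow> 'a list \<Rightarrow> real mat" where
  "signless_laplacian G vs = degree_mat G vs + adjacency_mat G vs"

definition vertex_list :: "('a, 'b) pre_digraph \<Rightarrow> 'a list" where
  "vertex_list G = (SOME vs. distinct vs \<and> set vs = verts G)"

text \<open>
  The spectrum here consists of the real eigenvalues; since the matrix is real symmetric, these are
  all its eigenvalues.
\<close>

definition Q_index :: "('a, 'b) pre_digraph \<Rightarrow> real" where
  "Q_index G = Max (spectrum (signless_laplacian G (vertex_list G)))"

text \<open>The choice of the enumeration is immaterial.\<close>

lemma spectrum_signless_laplacian:
  assumes d: "distinct vs" and s: "set vs = verts G"
  shows "spectrum (signless_laplacian G vs) =
    {k. \<exists>x. (\<exists>v\<in>verts G. x v \<noteq> 0) \<and>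
      (\<forall>u\<in>verts G. real (out_degree G u) * x u
         + (\<Sum>v\<in>verts G. if (u, v) \<in> arcs_ends G then x v else 0) = k * x u)}"
    (is "_ = {k. \<exists>x. ?P k x}")
proof -
  let ?n = "length vs" and ?Q = "signless_laplacian G vs"
  have bij: "bij_betw ((!) vs) {0..<?n} (verts G)"
    using bij_betw_nth[OF d refl s[symmetric]] by (simp add: lessThan_atLeast0)
  have Q: "?Q \<in> carrier_mat ?n ?n"
    by (auto simp: signless_laplacian_def degree_mat_def adjacency_mat_def)
  have row: "(?Q *\<^sub>v vec ?n (\<lambda>i. x (vs ! i))) $ i = real (out_degree G (vs ! i)) * x (vs ! i)
      + (\<Sum>v\<in>verts G. if (vs ! i, v) \<in> arcs_ends G then x v else 0)"
    if i: "i < ?n" for i x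
  proof -
    have "(?Q *\<^sub>v vec ?n (\<lambda>i. x (vs ! i))) $ i = (\<Sum>j = 0..<?n. ?Q $$ (i, j) * x (vs ! j))"
      using i Q by (simp add: scalar_prod_def)
    also have "\<dots> = (\<Sum>j = 0..<?n.
        (if i = j then real (out_degree G (vs ! i)) * x (vs ! j) else 0)
        + (if (vs ! i, vs ! j) \<in> arcs_ends G then x (vs ! j) else 0))"
      using i by (intro sum.cong)
        (simp_all add: signless_laplacian_def degree_mat_def adjacency_mat_def algebra_simps)
    also have "\<dots> = real (out_degree G (vs ! i)) * x (vs ! i)
        + (\<Sum>j = 0..<?n. if (vs ! i, vs ! j) \<in> arcs_ends G then x (vs ! j) else 0)"
      using i by (simp add: sum.distrib sum.delta')
    also have "(\<Sum>j = 0..<?n. if (vs ! i, vs ! j) \<in> arcs_ends G then x (vs ! j) else 0)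
        = (\<Sum>v\<in>verts G. if (vs ! i, v) \<in> arcs_ends G then x v else 0)"
      by (rule sum.reindex_bij_betw[OF bij])
    finally show ?thesis .
  qed
  have key: "eigenvector ?Q (vec ?n (\<lambda>i. x (vs ! i))) k \<longleftrightarrow> ?P k x" for k x
  proof -
    have all: "(\<forall>i<?n. R (vs ! i)) \<longleftrightarrow> (\<forall>v\<in>verts G. R v)" for R
      unfolding s[symmetric] by (simp add: all_set_conv_all_nth)
    have "vec ?n (\<lambda>i. x (vs ! i)) = 0\<^sub>v ?n \<longleftrightarrow> (\<forall>i<?n. x (vs ! i) = 0)"
      by (auto simp: vec_eq_iff)
    then have nz: "vec ?n (\<lambda>i. x (vs ! i)) \<noteq> 0\<^sub>v ?n \<longleftrightarrow> (\<exists>v\<in>verts G. x v \<noteq> 0)"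
      using all[of "\<lambda>v. x v = 0"] by blast
    have "?Q *\<^sub>v vec ?n (\<lambda>i. x (vs ! i)) = k \<cdot>\<^sub>v vec ?n (\<lambda>i. x (vs ! i)) \<longleftrightarrow>
      (\<forall>i<?n. real (out_degree G (vs ! i)) * x (vs ! i)
        + (\<Sum>v\<in>verts G. if (vs ! i, v) \<in> arcs_ends G then x v else 0) = k * x (vs ! i))"
      using Q by (simp add: vec_eq_iff row del: index_mult_mat_vec)
    also have "\<dots> \<longleftrightarrow> (\<forall>u\<in>verts G. real (out_degree G u) * x u
        + (\<Sum>v\<in>verts G. if (u, v) \<in> arcs_ends G then x v else 0) = k * x u)"
      by (rule all)
    finally show ?thesis
      using Q nz by (simp add: eigenvector_def)
  qed
  have rep: "\<exists>x. w = vec ?n (\<lambda>i. x (vs ! i))" if w: "w \<in> carrier_vec ?n" for w :: "real vec"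
  proof
    let ?x = "\<lambda>v. w $ the_inv_into {0..<?n} ((!) vs) v"
    show "w = vec ?n (\<lambda>i. ?x (vs ! i))"
      using w by (intro eq_vecI) (simp_all add: the_inv_into_f_f[OF bij_betw_imp_inj_on[OF bij]])
  qed
  have "eigenvalue ?Q k \<longleftrightarrow> (\<exists>x. ?P k x)" for k
  proof
    assume "eigenvalue ?Q k"
    then obtain w where w: "eigenvector ?Q w k" by (auto simp: eigenvalue_def)
    then have "w \<in> carrier_vec ?n" using Q by (auto simp: eigenvector_def)
    then obtain x where "w = vec ?n (\<lambda>i. x (vs ! i))" using rep by blast
    with w have "?P k x" using key by blast
    then show "\<exists>x. ?P k x" by blast
  next
    assume "\<exists>x. ?P k x"
    then obtain x where "?P k x" by blast
    then have "eigenvector ?Q (vec ?n (\<lambda>i. x (vs ! i))) k" using key by blast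
    then show "eigenvalue ?Q k" unfolding eigenvalue_def by blast
  qed
  then show ?thesis unfolding spectrum_def by (rule Collect_cong)
qed

lemma Q_index_eq:
  assumes "distinct vs" and "set vs = verts G"
  shows "Q_index G = Max (spectrum (signless_laplacian G vs))"
proof -
  have "distinct (vertex_list G) \<and> set (vertex_list G) = verts G"
    unfolding vertex_list_def by (rule someI[of _ vs]) (use assms in simp)
  then show ?thesis
    using assms by (simp add: Q_index_def spectrum_signless_laplacian)
qed

end

theory Submission
  imports Defs "HOL-Analysis.Product_Topology"
begin

text \<open>(i) By Merris' bound, \<open>q \<le> max (d v + m v)\<close> with \<open>m v\<close> the average degree of the
  neighbours of \<open>v\<close>. If \<open>d v \<le> 2\<close>, use \<open>m v \<le> s\<close>; otherwise the degrees of \<open>v\<close> and its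
  neighbours sum to at most \<open>2 m \<le> 3 s\<close>, so \<open>d v + m v \<le> d v + 3 s / d v - 1 \<le> s + 2\<close>, by
  convexity in \<open>d v \<in> [3, s]\<close>.
  (ii) The Rayleigh quotient at the Perron vector of the star around a vertex of degree \<open>\<Delta>\<close> is
  \<open>\<Delta> + 1\<close> on the star itself, and any further edge leaving a leaf increases it.\<close>

section \<open>The largest eigenvalue of a symmetric matrix\<close>

text \<open>Near 0 the linear term dominates, so a nonzero \<open>b\<close> would give a negative
  value at some small \<open>t\<close> of opposite sign.\<close>

lemma linear_coefficient_zero:
  fixes b c :: real
  assumes "\<And>t. b * t + c * t\<^sup>2 \<ge> 0"
  shows "b = 0"
proof (rule ccontr)
  assume b: "b \<noteq> 0"
  \<comment> \<open>The minimiser of \<open>b * t + (\<bar>c\<bar> + 1) * t\<^sup>2\<close>; the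
    \<open>+ 1\<close> keeps the leading coefficient positive when \<open>c = 0\<close>.\<close>
  define t where "t = - b / (2 * (\<bar>c\<bar> + 1))"
  have "b * t + c * t\<^sup>2 \<le> b * t + (\<bar>c\<bar> + 1) * t\<^sup>2"
    by (intro add_left_mono mult_right_mono) auto
  also have "\<dots> = - b\<^sup>2 / (4 * (\<bar>c\<bar> + 1))"
  proof -
    define e where "e = \<bar>c\<bar> + 1"
    have "e > 0" by (simp add: e_def)
    then show ?thesis
      unfolding t_def e_def[symmetric] by (simp add: field_simps power2_eq_square)
  qed
  also have "\<dots> < 0"
    using b by (simp add: divide_neg_pos)
  finally show False using assms[of t] by linarith
qed

text \<open>The type \<open>'a\<close> may be infinite, so coordinates outside \<open>V\<close> are
  pinned to 0. The sphere is then a closed subset of a product of compact sets, and Tychonoff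
  applies.\<close>

lemma compact_unit_sphere_fun:
  fixes V :: "'a set"
  assumes "finite V"
  shows "compact {x :: 'a \<Rightarrow> real. (\<forall>v. v \<notin> V \<longrightarrow> x v = 0) \<and> (\<Sum>v\<in>V. (x v)\<^sup>2) = 1}"
proof -
  let ?B = "\<lambda>v. if v \<in> V then {-1..1::real} else {0}"
  let ?S = "{x :: 'a \<Rightarrow> real. (\<forall>v. v \<notin> V \<longrightarrow> x v = 0) \<and> (\<Sum>v\<in>V. (x v)\<^sup>2) = 1}"
  have "compactin (product_topology (\<lambda>_. euclidean) UNIV) (PiE UNIV ?B)"
    unfolding compactin_PiE by simp
  then have box: "compact (PiE UNIV ?B)"
    by (simp add: euclidean_product_topology)
  have "continuous_on UNIV (\<lambda>x :: 'a \<Rightarrow> real. \<Sum>v\<in>V. (x v)\<^sup>2)"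
    by (intro continuous_intros continuous_on_product_coordinates)
  then have cl: "closed {x :: 'a \<Rightarrow> real. (\<Sum>v\<in>V. (x v)\<^sup>2) = 1}"
    by (intro closed_Collect_eq) auto
  have "x v \<in> {-1..1}" if "(\<Sum>v\<in>V. (x v)\<^sup>2) = 1" "v \<in> V" for x :: "'a \<Rightarrow> real" and v
  proof -
    have "(x v)\<^sup>2 \<le> (\<Sum>v\<in>V. (x v)\<^sup>2)"
      using that assms by (intro member_le_sum) auto
    then have "\<bar>x v\<bar> \<le> 1"
      using that(1) by (simp add: abs_square_le_1)
    then show ?thesis by auto
  qed
  then have "?S = PiE UNIV ?B \<inter> {x. (\<Sum>v\<in>V. (x v)\<^sup>2) = 1}"
    by (auto simp: PiE_iff split: if_splits)
  then show ?thesis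
    using compact_Int_closed[OF box cl] by simp
qed

text \<open>The eigenvector is a maximiser \<open>x\<close> of the quadratic form on the unit sphere: \<open>k I - A\<close> is then
  positive semidefinite and vanishes at \<open>x\<close>, and varying \<open>x\<close> in the direction of the
  residual \<open>A x - k x\<close> shows that the residual is zero.\<close>

lemma symmetric_eigenvalue_max_form:
  fixes a :: "'a \<Rightarrow> 'a \<Rightarrow> real"
  assumes fin: "finite V" and ne: "V \<noteq> {}"
    and sym: "\<And>u v. u \<in> V \<Longrightarrow> v \<in> V \<Longrightarrow> a u v = a v u"
  obtains x k where "\<exists>v\<in>V. x v \<noteq> 0"
    and "\<And>u. u \<in> V \<Longrightarrow> (\<Sum>v\<in>V. a u v * x v) = k * x u"
    and "\<And>y. (\<Sum>u\<in>V. \<Sum>v\<in>V. a u v * y u * y v) \<le> k * (\<Sum>v\<in>V. (y v)\<^sup>2)"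
proof -
  define S where "S = {x :: 'a \<Rightarrow> real. (\<forall>v. v \<notin> V \<longrightarrow> x v = 0) \<and> (\<Sum>v\<in>V. (x v)\<^sup>2) = 1}"
  define B where "B y z = (\<Sum>u\<in>V. \<Sum>v\<in>V. a u v * y u * z v)" for y z :: "'a \<Rightarrow> real"
  define N where "N y = (\<Sum>v\<in>V. (y v)\<^sup>2)" for y :: "'a \<Rightarrow> real"
  obtain w where w: "w \<in> V" using ne by blast
  have "(\<Sum>v\<in>V. (if v = w then 1 else 0 :: real)\<^sup>2) = (\<Sum>v\<in>V. if v = w then 1 else 0)"
    by (intro sum.cong) auto
  then have "(\<lambda>v. if v = w then 1 else 0) \<in> S"
    using w fin by (simp add: S_def)
  then have "S \<noteq> {}" by blast
  moreover have "continuous_on S (\<lambda>x. B x x)"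
    unfolding B_def
    by (intro continuous_intros continuous_on_subset[OF continuous_on_product_coordinates subset_UNIV])
  ultimately obtain x where x: "x \<in> S" and xmax: "\<And>y. y \<in> S \<Longrightarrow> B y y \<le> B x x"
    using continuous_attains_sup[OF compact_unit_sphere_fun[OF fin, folded S_def]] by blast
  define k where "k = B x x"
  have Nx: "N x = 1" using x by (simp add: N_def S_def)
  \<comment> \<open>Both sides are homogeneous of degree 2 and depend only on the values on
    \<open>V\<close>, so \<open>y\<close> can be scaled into \<open>S\<close> and set to 0 outside
    \<open>V\<close>.\<close>
  have le: "B y y \<le> k * N y" for y
  proof (cases "N y = 0")
    case True
    then have "\<forall>v\<in>V. y v = 0"
      using fin by (simp add: N_def sum_nonneg_eq_0_iff)
    then show ?thesis using True by (simp add: B_def)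
  next
    case False
    then have pos: "N y > 0" by (simp add: N_def sum_nonneg less_le)
    define c where "c = 1 / sqrt (N y)"
    have c2: "c * c * N y = 1" using pos by (simp add: c_def)
    let ?y = "\<lambda>v. if v \<in> V then c * y v else 0"
    have "(\<Sum>v\<in>V. (?y v)\<^sup>2) = c * c * N y"
      by (simp add: N_def sum_distrib_left power2_eq_square mult_ac)
    then have "B ?y ?y \<le> k" using c2 unfolding k_def by (intro xmax) (auto simp: S_def)
    moreover have "B ?y ?y = c * c * B y y"
      by (simp add: B_def sum_distrib_left mult_ac)
    ultimately have "c * c * B y y * N y \<le> k * N y"
      using pos by (intro mult_right_mono) auto
    moreover have "c * c * B y y * N y = (c * c * N y) * B y y" by simp
    ultimately show ?thesis unfolding c2 by simp
  qed
  define r where "r u = (\<Sum>v\<in>V. a u v * x v) - k * x u" for u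
  have Bsym: "B x r = B r x"
    unfolding B_def by (subst sum.swap) (intro sum.cong, auto simp: sym mult_ac)
  have Brx: "B r x = N r + k * (\<Sum>u\<in>V. r u * x u)"
  proof -
    have "B r x = (\<Sum>u\<in>V. r u * (\<Sum>v\<in>V. a u v * x v))"
      by (simp add: B_def sum_distrib_left mult_ac)
    also have "\<dots> = (\<Sum>u\<in>V. r u * (r u + k * x u))" by (simp add: r_def)
    finally show ?thesis
      by (simp add: N_def power2_eq_square algebra_simps sum.distrib sum_distrib_left)
  qed
  \<comment> \<open>The left side is \<open>k * N z - B z z\<close> for \<open>z = x + t r\<close>.
    The constant term vanishes because \<open>B x x = k\<close> and \<open>N x = 1\<close>; in the
    linear term the inner products of \<open>r\<close> and \<open>x\<close> cancel by
    \<open>Brx\<close>.\<close>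
  have "- 2 * N r * t + (k * N r - B r r) * t\<^sup>2 \<ge> 0" for t
  proof -
    let ?z = "\<lambda>u. x u + t * r u"
    have "B ?z ?z = B x x + t * B x r + t * B r x + t\<^sup>2 * B r r"
      by (simp add: B_def algebra_simps sum.distrib sum_distrib_left power2_eq_square)
    moreover have "N ?z = N x + 2 * t * (\<Sum>u\<in>V. r u * x u) + t\<^sup>2 * N r"
      by (simp add: N_def algebra_simps sum.distrib sum_distrib_left power2_eq_square)
    ultimately show ?thesis
      using le[of ?z] Nx Bsym Brx by (simp add: algebra_simps k_def)
  qed
  then have "- 2 * N r = 0" by (rule linear_coefficient_zero)
  then have "\<forall>u\<in>V. r u = 0"
    using fin by (simp add: N_def sum_nonneg_eq_0_iff)
  moreover have "\<exists>v\<in>V. x v \<noteq> 0"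
    using Nx by (auto simp: N_def intro: ccontr)
  ultimately show ?thesis
    using that[of x k] le by (simp add: r_def B_def N_def)
qed

section \<open>Bounds on the Q-index\<close>

lemma (in graph) spectrum_Q_conv:
  "spectrum (signless_laplacian G (vertex_list G)) =
    {k. \<exists>x. (\<exists>v\<in>verts G. x v \<noteq> 0) \<and>
      (\<forall>u\<in>verts G. real (out_degree G u) * x u
         + (\<Sum>v\<in>verts G. if (u, v) \<in> arcs_ends G then x v else 0) = k * x u)}"
proof -
  have "\<exists>vs. distinct vs \<and> set vs = verts G"
    using finite_distinct_list[OF finite_verts] by blast
  then have "distinct (vertex_list G) \<and> set (vertex_list G) = verts G"
    unfolding vertex_list_def by (rule someI_ex)
  then show ?thesis by (simp add: spectrum_signless_laplacian)
qed

lemma finite_spectrum_Q: "finite (spectrum (signless_laplacian G vs))"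
  by (rule card_finite_spectrum(1)[of _ "length vs"])
    (simp add: signless_laplacian_def degree_mat_def adjacency_mat_def)

section \<open>Degrees, neighbourhoods and sums over arcs\<close>

lemma (in graph) finite_arcs_ends: "finite (arcs_ends G)"
  by (simp add: arcs_ends_def)

lemma (in graph) finite_neighbours: "finite {v. (u, v) \<in> arcs_ends G}"
  by (rule finite_subset[OF _ finite_verts]) (auto simp: adj_in_verts)

lemma (in graph) out_degree_eq_card: "out_degree G u = card {v. (u, v) \<in> arcs_ends G}"
proof -
  have "inj_on (head G) (out_arcs G u)"
    by (auto simp: inj_on_def arc_to_ends_def intro!: no_multi_arcs)
  moreover have "head G ` out_arcs G u = {v. (u, v) \<in> arcs_ends G}"
    by (auto simp: arcs_ends_conv)
  ultimately show ?thesis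
    unfolding out_degree_def by (metis card_image)
qed

lemma (in graph) sum_arcs_ends:
  fixes f :: "'a \<Rightarrow> 'a \<Rightarrow> 'c::comm_monoid_add"
  shows "(\<Sum>(u, v)\<in>arcs_ends G. f u v) =
    (\<Sum>u\<in>verts G. \<Sum>v\<in>verts G. if (u, v) \<in> arcs_ends G then f u v else 0)"
proof -
  have "(\<Sum>u\<in>verts G. \<Sum>v\<in>verts G. if (u, v) \<in> arcs_ends G then f u v else 0) =
      (\<Sum>p\<in>verts G \<times> verts G. if p \<in> arcs_ends G then (case p of (u, v) \<Rightarrow> f u v) else 0)"
    by (simp add: sum.cartesian_product) (auto intro!: sum.cong)
  also have "\<dots> = (\<Sum>p\<in>(verts G \<times> verts G) \<inter> arcs_ends G. case p of (u, v) \<Rightarrow> f u v)"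
    by (simp add: sum.inter_restrict)
  also have "(verts G \<times> verts G) \<inter> arcs_ends G = arcs_ends G"
    by (auto simp: adj_in_verts)
  finally show ?thesis by simp
qed

lemma (in graph) sum_neighbours:
  fixes f :: "'a \<Rightarrow> 'c::comm_monoid_add"
  shows "(\<Sum>v\<in>verts G. if (u, v) \<in> arcs_ends G then f v else 0) =
    sum f {v. (u, v) \<in> arcs_ends G}"
proof -
  have "{v \<in> verts G. (u, v) \<in> arcs_ends G} = {v. (u, v) \<in> arcs_ends G}"
    by (auto simp: adj_in_verts)
  then show ?thesis by (simp add: sum.inter_filter[symmetric])
qed

text \<open>\<open>a\<close> is the signless Laplacian indexed by vertices. Expanding the square
  gives two square sums, equal by arc reversal, and twice the adjacency form; the factor 2 reflects
  the two arcs of each edge.\<close>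

lemma (in graph) quadratic_form_Q:
  fixes x :: "'a \<Rightarrow> real"
  defines "a \<equiv> \<lambda>u v. (if u = v then real (out_degree G u) else 0)
    + (if (u, v) \<in> arcs_ends G then 1 else 0)"
  shows "2 * (\<Sum>u\<in>verts G. \<Sum>v\<in>verts G. a u v * x u * x v) =
    (\<Sum>(u, v)\<in>arcs_ends G. (x u + x v)\<^sup>2)"
proof -
  let ?E = "arcs_ends G"
  have deg: "(\<Sum>(u, v)\<in>?E. (x u)\<^sup>2) = (\<Sum>u\<in>verts G. real (out_degree G u) * (x u)\<^sup>2)"
    by (simp add: sum_arcs_ends sum_neighbours out_degree_eq_card)
  have "bij_betw prod.swap ?E ?E"
    by (intro bij_betwI[where g = prod.swap]) (auto dest: graph_symmetric)
  from sum.reindex_bij_betw[OF this, of "\<lambda>(u, v). (x u)\<^sup>2"]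
  have swap: "(\<Sum>(u, v)\<in>?E. (x v)\<^sup>2) = (\<Sum>(u, v)\<in>?E. (x u)\<^sup>2)"
    by (simp add: case_prod_beta)
  have "(\<Sum>u\<in>verts G. \<Sum>v\<in>verts G. a u v * x u * x v) =
    (\<Sum>u\<in>verts G. \<Sum>v\<in>verts G. (if u = v then real (out_degree G u) * (x u)\<^sup>2 else 0)
      + (if (u, v) \<in> ?E then x u * x v else 0))"
    by (intro sum.cong) (auto simp: a_def algebra_simps power2_eq_square)
  also have "\<dots> = (\<Sum>(u, v)\<in>?E. (x u)\<^sup>2) + (\<Sum>(u, v)\<in>?E. x u * x v)"
    unfolding deg by (simp add: sum.distrib sum_arcs_ends sum.delta')
  finally show ?thesis
    using swap by (simp add: power2_sum case_prod_beta sum.distrib sum_distrib_left mult_ac)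
qed

text \<open>The maximal value \<open>k\<close> of the form is an eigenvalue, so the
  \<open>Max\<close> in \<open>Q_index\<close> ranges over a nonempty finite set and is at least
  \<open>k\<close>.\<close>

lemma (in graph) Q_index_Rayleigh:
  assumes "verts G \<noteq> {}"
  shows Q_index_in_spectrum: "Q_index G \<in> spectrum (signless_laplacian G (vertex_list G))"
    and Q_index_ge: "(\<Sum>(u, v)\<in>arcs_ends G. (y u + y v)\<^sup>2) \<le> 2 * Q_index G * (\<Sum>v\<in>verts G. (y v)\<^sup>2)"
proof -
  let ?S = "spectrum (signless_laplacian G (vertex_list G))"
  define a where "a = (\<lambda>u v. (if u = v then real (out_degree G u) else 0)
    + (if (u, v) \<in> arcs_ends G then 1 else 0))"
  have "a u v = a v u" for u v
    using graph_symmetric[of u v] graph_symmetric[of v u] by (auto simp: a_def)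
  then obtain x k where nz: "\<exists>v\<in>verts G. x v \<noteq> 0"
    and eig: "\<And>u. u \<in> verts G \<Longrightarrow> (\<Sum>v\<in>verts G. a u v * x v) = k * x u"
    and form: "\<And>y. (\<Sum>u\<in>verts G. \<Sum>v\<in>verts G. a u v * y u * y v) \<le> k * (\<Sum>v\<in>verts G. (y v)\<^sup>2)"
    using symmetric_eigenvalue_max_form[OF finite_verts assms, of a] by blast
  have "real (out_degree G u) * x u + (\<Sum>v\<in>verts G. if (u, v) \<in> arcs_ends G then x v else 0) = k * x u"
    if "u \<in> verts G" for u
  proof -
    have "(\<Sum>v\<in>verts G. a u v * x v) = (\<Sum>v\<in>verts G. (if u = v then real (out_degree G u) * x u else 0)
        + (if (u, v) \<in> arcs_ends G then x v else 0))"
      by (intro sum.cong) (auto simp: a_def algebra_simps)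
    also have "\<dots> = real (out_degree G u) * x u
        + (\<Sum>v\<in>verts G. if (u, v) \<in> arcs_ends G then x v else 0)"
      using that by (simp add: sum.distrib sum.delta')
    finally show ?thesis using eig[OF that] by simp
  qed
  with nz have k: "k \<in> ?S" unfolding spectrum_Q_conv by blast
  then show "Q_index G \<in> ?S"
    unfolding Q_index_def by (intro Max_in finite_spectrum_Q) auto
  have "k \<le> Q_index G"
    unfolding Q_index_def using k by (intro Max_ge finite_spectrum_Q)
  then have "k * (\<Sum>v\<in>verts G. (y v)\<^sup>2) \<le> Q_index G * (\<Sum>v\<in>verts G. (y v)\<^sup>2)"
    by (intro mult_right_mono) (auto simp: sum_nonneg)
  with form[of y] show "(\<Sum>(u, v)\<in>arcs_ends G. (y u + y v)\<^sup>2) \<le> 2 * Q_index G * (\<Sum>v\<in>verts G. (y v)\<^sup>2)"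
    using quadratic_form_Q[of y] by (simp add: a_def)
qed

text \<open>Merris' bound: compare the entries of an eigenvector with the degrees, at a vertex where
  \<open>\<bar>x v\<bar> / d v\<close> is largest.\<close>

lemma (in graph) Q_index_le:
  assumes ne: "verts G \<noteq> {}"
    and pos: "\<And>v. v \<in> verts G \<Longrightarrow> out_degree G v > 0"
    and bound: "\<And>u. u \<in> verts G \<Longrightarrow> real (out_degree G u) * real (out_degree G u)
      + (\<Sum>v | (u, v) \<in> arcs_ends G. real (out_degree G v)) \<le> K * real (out_degree G u)"
  shows "Q_index G \<le> K"
proof -
  let ?d = "\<lambda>v. real (out_degree G v)" and ?k = "Q_index G"
  obtain x where nz: "\<exists>v\<in>verts G. x v \<noteq> 0" and eig: "\<And>u. u \<in> verts G \<Longrightarrow>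
      ?d u * x u + (\<Sum>v | (u, v) \<in> arcs_ends G. x v) = ?k * x u"
    using Q_index_in_spectrum[OF ne] unfolding spectrum_Q_conv sum_neighbours by blast
  define g where "g v = \<bar>x v\<bar> / ?d v" for v
  obtain u where u: "u \<in> verts G" and umax: "\<And>v. v \<in> verts G \<Longrightarrow> g v \<le> g u"
  proof -
    have "Max (g ` verts G) \<in> g ` verts G" using ne by (intro Max_in) auto
    then show ?thesis using that by (metis Max_ge finite_imageI finite_verts imageE imageI)
  qed
  have xg: "\<bar>x v\<bar> = g v * ?d v" if "v \<in> verts G" for v
    using pos[OF that] by (simp add: g_def)
  have gpos: "g u > 0"
  proof -
    obtain v where "v \<in> verts G" "x v \<noteq> 0" using nz by blast
    then have "g v > 0" using pos by (simp add: g_def)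
    with umax \<open>v \<in> verts G\<close> show ?thesis by (meson less_le_trans)
  qed
  \<comment> \<open>Absolute values in the eigenvalue equation at \<open>u\<close> allow entries of
    either sign.\<close>
  have "?k * \<bar>x u\<bar> \<le> \<bar>?k * x u\<bar>"
    by (simp add: abs_mult mult_right_mono)
  also have "\<dots> \<le> ?d u * \<bar>x u\<bar> + (\<Sum>v | (u, v) \<in> arcs_ends G. \<bar>x v\<bar>)"
    unfolding eig[OF u, symmetric]
    by (rule order_trans[OF abs_triangle_ineq]) (simp add: abs_mult)
  also have "(\<Sum>v | (u, v) \<in> arcs_ends G. \<bar>x v\<bar>) \<le> (\<Sum>v | (u, v) \<in> arcs_ends G. g u * ?d v)"
    by (intro sum_mono) (auto simp: xg adj_in_verts intro!: mult_right_mono umax)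
  also have "?d u * \<bar>x u\<bar> + \<dots> = g u * (?d u * ?d u + (\<Sum>v | (u, v) \<in> arcs_ends G. ?d v))"
    by (simp add: xg[OF u] sum_distrib_left algebra_simps)
  \<comment> \<open>\<open>bound\<close> is Merris' condition, degree plus average neighbour degree
    at most \<open>K\<close>, multiplied by the degree of \<open>u\<close>.\<close>
  also have "\<dots> \<le> g u * (K * ?d u)"
    using gpos bound[OF u] by (intro mult_left_mono) auto
  finally have "?k * (g u * ?d u) \<le> K * (g u * ?d u)"
    by (simp add: xg[OF u] algebra_simps)
  moreover have "g u * ?d u > 0" using gpos pos[OF u] by simp
  ultimately show ?thesis by (simp only: mult_le_cancel_right_pos)
qed

section \<open>Counting edges\<close>

text \<open>Handshake lemma: count arcs by start vertex and by underlying edge. Without loops, each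
  edge carries exactly two arcs.\<close>

lemma (in graph) sum_out_degree: "(\<Sum>v\<in>verts G. out_degree G v) = 2 * card (edge_set G)"
proof -
  let ?f = "\<lambda>(u, v). {u, v}"
  have im: "edge_set G = ?f ` arcs_ends G"
    by (auto simp: edge_set_def image_def)
  have fibre: "card {p \<in> arcs_ends G. ?f p = e} = 2" if mem: "e \<in> edge_set G" for e
  proof -
    obtain u v where e: "e = {u, v}" and uv: "(u, v) \<in> arcs_ends G"
      using mem by (auto simp: edge_set_def)
    have "u \<noteq> v" using uv adj_not_same by blast
    moreover have "{p \<in> arcs_ends G. ?f p = e} = {(u, v), (v, u)}"
      using uv graph_symmetric by (auto simp: e doubleton_eq_iff)
    ultimately show ?thesis by simp
  qed
  have "(\<Sum>v\<in>verts G. out_degree G v) = (\<Sum>(u, v)\<in>arcs_ends G. 1)"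
    unfolding sum_arcs_ends sum_neighbours by (simp add: out_degree_eq_card)
  also have "\<dots> = card (arcs_ends G)" by simp
  also have "\<dots> = (\<Sum>e\<in>edge_set G. card {p \<in> arcs_ends G. ?f p = e})"
    using sum.image_gen[OF finite_arcs_ends, of "\<lambda>_. 1::nat" ?f] by (simp add: im)
  also have "\<dots> = 2 * card (edge_set G)" by (simp add: fibre)
  finally show ?thesis .
qed

text \<open>Connectedness refers to \<open>mk_symmetric G\<close>, which has the same reachability
  as the symmetric \<open>G\<close>; induction along a walk from \<open>v\<close> then stays in
  \<open>A\<close>.\<close>

lemma (in graph) connected_closed_set:
  assumes "Digraph_Component.connected G" and "v \<in> A" "v \<in> verts G"
    and closed: "\<And>x y. x \<in> A \<Longrightarrow> (x, y) \<in> arcs_ends G \<Longrightarrow> y \<in> A"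
  shows "verts G \<subseteq> A"
proof
  fix w assume "w \<in> verts G"
  then have "v \<rightarrow>\<^sup>*\<^bsub>mk_symmetric G\<^esub> w"
    using assms by (auto simp: connected_def strongly_connected_def)
  then have "v \<rightarrow>\<^sup>* w" using reachable_mk_symmetric_eq[OF sym_arcs] by simp
  then show "w \<in> A"
    by (induction rule: reachable_induct) (use assms in blast)+
qed

text \<open>An isolated \<open>v\<close> forms a closed set, hence is the only vertex, leaving no
  room for an arc.\<close>

lemma (in graph) out_degree_pos:
  assumes conn: "Digraph_Component.connected G" and "arcs_ends G \<noteq> {}" and v: "v \<in> verts G"
  shows "out_degree G v > 0"
proof (rule ccontr)
  assume "\<not> ?thesis"
  then have "{w. (v, w) \<in> arcs_ends G} = {}"
    using finite_neighbours by (simp add: out_degree_eq_card)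
  moreover from this have "verts G \<subseteq> {v}"
    by (intro connected_closed_set[OF conn _ v]) auto
  ultimately show False
    using assms(2) adj_in_verts by fastforce
qed

text \<open>Otherwise \<open>v\<close> and its neighbours form a closed set and the graph is a star
  at \<open>v\<close>, with no more edges than the degree of \<open>v\<close>.\<close>

lemma (in graph) path_of_length_two:
  assumes conn: "Digraph_Component.connected G" and v: "v \<in> verts G"
    and less: "out_degree G v < card (edge_set G)"
  obtains w z where "(v, w) \<in> arcs_ends G" "(w, z) \<in> arcs_ends G" "z \<noteq> v"
proof (rule ccontr)
  let ?N = "{w. (v, w) \<in> arcs_ends G}"
  assume "\<not> thesis"
  then have no: "z = v" if "w \<in> ?N" "(w, z) \<in> arcs_ends G" for w z
    using that \<open>\<And>w z. \<lbrakk>(v, w) \<in> arcs_ends G; (w, z) \<in> arcs_ends G; z \<noteq> v\<rbrakk> \<Longrightarrow> thesis\<close> by blast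
  have V: "verts G \<subseteq> insert v ?N"
    using no by (intro connected_closed_set[OF conn _ v]) auto
  have "edge_set G \<subseteq> (\<lambda>w. {v, w}) ` ?N"
  proof
    fix e assume "e \<in> edge_set G"
    then obtain u w where e: "e = {u, w}" and uw: "(u, w) \<in> arcs_ends G"
      by (auto simp: edge_set_def)
    show "e \<in> (\<lambda>w. {v, w}) ` ?N"
    proof (cases "u = v")
      case True then show ?thesis using e uw by blast
    next
      case False
      then have "u \<in> ?N" using V adj_in_verts[OF uw] by blast
      then show ?thesis using no[OF _ uw] e by blast
    qed
  qed
  then have "card (edge_set G) \<le> card ?N"
    using finite_neighbours by (meson surj_card_le)
  then show False using less by (simp add: out_degree_eq_card)
qed

section \<open>The two bounds on the Q-index\<close>

lemma (in graph) Q_index_gt_degree: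
  assumes conn: "Digraph_Component.connected G" and v: "v \<in> verts G"
    and less: "out_degree G v < card (edge_set G)" and pos: "out_degree G v > 0"
  shows "Q_index G > real (out_degree G v) + 1"
proof -
  let ?N = "{w. (v, w) \<in> arcs_ends G}" and ?D = "real (out_degree G v)"
  obtain w z where w: "(v, w) \<in> arcs_ends G" and wz: "(w, z) \<in> arcs_ends G" and z: "z \<noteq> v"
    using path_of_length_two[OF conn v less] by blast
  \<comment> \<open>\<open>y\<close> is the Perron vector of the star at \<open>v\<close>\<close>
  define y where "y u = (if u = v then ?D else if u \<in> ?N then 1 else 0)" for u
  have vN: "v \<notin> ?N" using adj_not_same by blast
  have wv: "w \<noteq> v" using w vN by auto
  let ?f = "\<lambda>(a, b). (y a + y b)\<^sup>2"
  let ?A = "Pair v ` ?N" and ?B = "(\<lambda>u. (u, v)) ` ?N"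
  have fN: "finite ?N" by (rule finite_neighbours)
  have yv: "y v = ?D" and yN: "y u = 1" if "u \<in> ?N" for u
    using that vN by (auto simp: y_def)
  have A: "sum ?f ?A = ?D * (?D + 1)\<^sup>2"
  proof -
    have "sum ?f ?A = (\<Sum>u\<in>?N. (?D + 1)\<^sup>2)"
      by (subst sum.reindex) (auto simp: inj_on_def yv yN intro!: sum.cong)
    then show ?thesis by (simp add: out_degree_eq_card[of v])
  qed
  have B: "sum ?f ?B = ?D * (?D + 1)\<^sup>2"
  proof -
    have "sum ?f ?B = (\<Sum>u\<in>?N. (?D + 1)\<^sup>2)"
      by (subst sum.reindex) (auto simp: inj_on_def yv yN add.commute intro!: sum.cong)
    then show ?thesis by (simp add: out_degree_eq_card[of v])
  qed
  have wz_pos: "?f (w, z) > 0"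
    using w wv by (simp add: y_def)
  \<comment> \<open>\<open>?A\<close> and \<open>?B\<close> are the two orientations of the star.
    The arc \<open>(w, z)\<close> lies in neither, and its term is positive because
    \<open>y w = 1\<close> and \<open>y z \<ge> 0\<close>.\<close>
  have "2 * (?D * (?D + 1)\<^sup>2) < ?f (w, z) + (sum ?f ?A + sum ?f ?B)"
    using A B wz_pos by linarith
  also have "sum ?f ?A + sum ?f ?B = sum ?f (?A \<union> ?B)"
    using fN vN by (intro sum.union_disjoint[symmetric]) auto
  also have "?f (w, z) + \<dots> = sum ?f (insert (w, z) (?A \<union> ?B))"
    using fN wv z by (intro sum.insert[symmetric]) auto
  also have "\<dots> \<le> sum ?f (arcs_ends G)"
    using wz graph_symmetric by (intro sum_mono2 finite_arcs_ends) auto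
  also have "\<dots> \<le> 2 * Q_index G * (\<Sum>u\<in>verts G. (y u)\<^sup>2)"
    using Q_index_ge[of y] v by auto
  also have "(\<Sum>u\<in>verts G. (y u)\<^sup>2) = (\<Sum>u\<in>insert v ?N. (y u)\<^sup>2)"
    using v adj_in_verts by (intro sum.mono_neutral_right) (auto simp: y_def)
  also have "\<dots> = ?D\<^sup>2 + (\<Sum>u\<in>?N. (y u)\<^sup>2)"
    using fN vN by (simp add: y_def)
  also have "(\<Sum>u\<in>?N. (y u)\<^sup>2) = (\<Sum>u\<in>?N. 1)"
    using vN by (intro sum.cong) (auto simp: y_def)
  also have "\<dots> = ?D" by (simp add: out_degree_eq_card)
  \<comment> \<open>The squared norm of \<open>y\<close> is \<open>?D * (?D + 1)\<close>, which
    cancels against the star's contribution to leave \<open>?D + 1\<close>.\<close>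
  finally have "(?D + 1) * (?D * (?D + 1)) < Q_index G * (?D * (?D + 1))"
    by (simp add: power2_eq_square algebra_simps)
  moreover have "?D * (?D + 1) > 0" using pos by simp
  ultimately show ?thesis by (simp only: mult_less_cancel_right_pos)
qed

lemma (in graph) Q_index_le_degree_bound:
  assumes conn: "Digraph_Component.connected G" and edges: "arcs_ends G \<noteq> {}"
    and deg: "\<And>v. v \<in> verts G \<Longrightarrow> out_degree G v \<le> s"
    and m: "2 * card (edge_set G) \<le> 3 * s"
  shows "Q_index G \<le> real s + 2"
proof (rule Q_index_le)
  show "verts G \<noteq> {}" using edges adj_in_verts by fastforce
  show "out_degree G v > 0" if "v \<in> verts G" for v
    using out_degree_pos[OF conn edges that] .
  fix u assume u: "u \<in> verts G"
  let ?d = "out_degree G u" and ?N = "{v. (u, v) \<in> arcs_ends G}"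
  have fN: "finite ?N" by (rule finite_neighbours)
  \<comment> \<open>Merris' condition for \<open>K = s + 2\<close>, first proved over the
    naturals.\<close>
  have "?d * ?d + (\<Sum>v\<in>?N. out_degree G v) \<le> (s + 2) * ?d"
  proof (cases "?d \<le> 2")
    case True
    have "(\<Sum>v\<in>?N. out_degree G v) \<le> (\<Sum>v\<in>?N. s)"
      by (intro sum_mono deg) (auto simp: adj_in_verts)
    also have "\<dots> = ?d * s" by (simp add: out_degree_eq_card)
    finally have "?d * ?d + (\<Sum>v\<in>?N. out_degree G v) \<le> 2 * ?d + ?d * s"
      using True by (intro add_mono mult_right_mono) auto
    then show ?thesis by (simp add: algebra_simps)
  next
    case False
    have "?d + (\<Sum>v\<in>?N. out_degree G v) = (\<Sum>v\<in>insert u ?N. out_degree G v)"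
      using fN adj_not_same by (subst sum.insert) auto
    also have "\<dots> \<le> (\<Sum>v\<in>verts G. out_degree G v)"
      using u adj_in_verts by (intro sum_mono2) auto
    also have "\<dots> \<le> 3 * s" using m by (simp add: sum_out_degree)
    finally have N: "?d + (\<Sum>v\<in>?N. out_degree G v) \<le> 3 * s" .
    \<comment> \<open>With \<open>a = d - 3\<close> and \<open>b = s - d\<close> written additively,
      truncated subtraction is avoided and the slack in the next inequality is
      \<open>a * b\<close>.\<close>
    obtain a b where ab: "?d = 3 + a" "s = 3 + a + b"
      using False deg[OF u] by (metis le_add_diff_inverse not_less_eq_eq numeral_2_eq_2 numeral_3_eq_3)
    \<comment> \<open>\<open>(d - 3) (s - d) \<ge> 0\<close>\<close>
    have "?d * ?d + 3 * s \<le> (s + 3) * ?d"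
      unfolding ab by (simp add: algebra_simps)
    with N show ?thesis by (simp add: algebra_simps)
  qed
  then have "real (?d * ?d + (\<Sum>v\<in>?N. out_degree G v)) \<le> real ((s + 2) * ?d)"
    by (rule of_nat_mono)
  then show "real ?d * real ?d + (\<Sum>v\<in>?N. real (out_degree G v)) \<le> (real s + 2) * real ?d"
    by (simp add: algebra_simps)
qed

theorem theorem2p7:
  fixes G :: "('a, 'b) pre_digraph" and m s :: nat
  assumes "Digraph.graph G"
    and "Digraph_Component.connected G"
    and "card (edge_set G) = m"
    and "m \<ge> 5"
    and "s > 0"
  shows "(max_degree G \<le> s \<and> real s \<ge> 2 * real m / 3 \<longrightarrow> Q_index G \<le> real s + 2)
    \<and> (s \<le> max_degree G \<and> max_degree G \<le> m - 1 \<longrightarrow> Q_index G > real s + 1)"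
proof -
  interpret graph G by (rule assms(1))
  have edges: "arcs_ends G \<noteq> {}"
    using assms(3,4) by (auto simp: edge_set_def)
  then have ne: "verts G \<noteq> {}" using adj_in_verts by fastforce
  have deg: "out_degree G v \<le> max_degree G" if "v \<in> verts G" for v
    unfolding max_degree_def using that by (intro Max_ge) auto
  have "max_degree G \<in> out_degree G ` verts G"
    unfolding max_degree_def using ne by (intro Max_in) auto
  then obtain v where v: "v \<in> verts G" "out_degree G v = max_degree G" by auto
  show ?thesis
  proof (intro conjI impI; elim conjE)
    assume "max_degree G \<le> s" "real s \<ge> 2 * real m / 3"
    then show "Q_index G \<le> real s + 2"
      using deg assms(3)
      by (intro Q_index_le_degree_bound[OF assms(2) edges]) (auto intro: order_trans)
  next
    assume "s \<le> max_degree G" "max_degree G \<le> m - 1"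
    \<comment> \<open>\<open>m \<ge> 5\<close> makes the truncated \<open>m - 1\<close> smaller than
      \<open>m\<close>, and \<open>0 < s \<le> max_degree G\<close> makes the degree of
      \<open>v\<close> positive.\<close>
    then have "real (max_degree G) + 1 < Q_index G"
      using Q_index_gt_degree[OF assms(2) v(1)] v(2) assms(3-5) by simp
    then show "Q_index G > real s + 1"
      using \<open>s \<le> max_degree G\<close> by simp
  qed
qed

end
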